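(* Consider the game $K^1$. A position $(a,b)\in\mathbb{N}^2$ with $a\le b$ is a $\mathcal{P}$-position of $K^1$ if and only if either $(a,b)\in\{(0,0),(0,1)\}$, or $a\ge 1$, $\mathrm{rep}_F(a)$ ends with the digit $0$ and $\mathrm{rep}_F(b)=\mathrm{rep}_F(a)1$ (the word $\mathrm{rep}_F(a)$ followed by the digit $1$).
   Context: Positions are pairs $(x,y)\in\mathbb{N}^2$. A Wythoff move from $(x,y)$ leads to $(x-i,y)$ with $1\le i\le x$, to $(x,y-i)$ with $1\le i\le y$, or to $(x-i,y-i)$ with $1\le i\le\min(x,y)$. For $\ell\in\mathbb{N}$, $K^\ell$ is the two-player impartial game with Wythoff moves in which the positions of $\{(x,y): x+y\le\ell\}$ are terminal: no move is allowed from a terminal position, and a player who moves into a terminal position wins (normal play: a player unable to move loses). A $\mathcal{P}$-position is a position from which the previous player (the one not about to move) has a winning strategy; in particular every terminal position is a $\mathcal{P}$-position. The Fibonacci sequence is $F_0=1$, $F_1=2$, $F_{n+2}=F_{n+1}+F_n$; for $n>0$, $\mathrm{rep}_F(n)$ is the greedy representation $d_k\cdots d_0$ over $\{0,1\}$ with $n=\sum d_iF_i$, $d_k\neq0$, no two consecutive $1$'s; $\mathrm{rep}_F(0)$ is the empty word. *)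

theory Defs
  imports Main "HOL-Number_Theory.Fib"
begin

section \<open>Wythoff's game with enlarged terminal set\<close>

type_synonym position = "nat \<times> nat"

fun wythoff_move :: "position \<Rightarrow> position \<Rightarrow> bool" where
  "wythoff_move (x, y) p \<longleftrightarrow>
     (\<exists>i. 1 \<le> i \<and> i \<le> x \<and> p = (x - i, y)) \<or>
     (\<exists>i. 1 \<le> i \<and> i \<le> y \<and> p = (x, y - i)) \<or>
     (\<exists>i. 1 \<le> i \<and> i \<le> min x y \<and> p = (x - i, y - i))"

definition terminal :: "nat \<Rightarrow> position \<Rightarrow> bool" where
  "terminal l p \<longleftrightarrow> fst p + snd p \<le> l"

definition K_move :: "nat \<Rightarrow> position \<Rightarrow> position \<Rightarrow> bool" where
  "K_move l p q \<longleftrightarrow> \<not> terminal l p \<and> wythoff_move p q"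

text \<open>
  A (partial) play is the nonempty list of the positions visited so far, oldest first. In a play
  \<open>h\<close> starting at \<open>p\<close>, the player about to move at \<open>p\<close> (the next player) makes the moves
  leading to \<open>h ! 1\<close>, \<open>h ! 3\<close>, \dots, and the other one (the previous player) those leading to
  \<open>h ! 2\<close>, \<open>h ! 4\<close>, \dots. Hence the next player is to move after \<open>h\<close> iff \<open>length h\<close> is odd.
\<close>

definition play_from :: "nat \<Rightarrow> position \<Rightarrow> position list \<Rightarrow> bool" where
  "play_from l p h \<longleftrightarrow> h \<noteq> [] \<and> hd h = p \<and> successively (K_move l) h"

definition finished :: "nat \<Rightarrow> position list \<Rightarrow> bool" where
  "finished l h \<longleftrightarrow> (\<nexists>q. K_move l (last h) q)"

text \<open>A strategy maps the history of the play to the position to move to.\<close>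

definition strategy :: "nat \<Rightarrow> (position list \<Rightarrow> position) \<Rightarrow> bool" where
  "strategy l s \<longleftrightarrow> (\<forall>h. h \<noteq> [] \<and> \<not> finished l h \<longrightarrow> K_move l (last h) (s h))"

definition prev_follows :: "(position list \<Rightarrow> position) \<Rightarrow> position list \<Rightarrow> bool" where
  "prev_follows s h \<longleftrightarrow> (\<forall>n. 0 < n \<and> n < length h \<and> even n \<longrightarrow> h ! n = s (take n h))"

text \<open>
  Every move decreases the sum of the coordinates, so no play is infinite and it suffices to look
  at finished plays; such a play is won by the previous player iff it is the next player who is
  unable to move.
\<close>

definition P_position :: "nat \<Rightarrow> position \<Rightarrow> bool" where
  "P_position l p \<longleftrightarrow>
     (\<exists>s. strategy l s \<and>
        (\<forall>h. play_from l p h \<and> prev_follows s h \<and> finished l h \<longrightarrow> odd (length h)))"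


section \<open>Fibonacci representations\<close>

definition F :: "nat \<Rightarrow> nat" where
  "F n = fib (n + 2)"

lemma F_simps: "F 0 = 1" "F (Suc 0) = 2" "F (Suc (Suc n)) = F (Suc n) + F n"
  by (simp_all add: F_def numeral_2_eq_2)

text \<open>Words are lists of digits with the most significant digit first.\<close>

definition val_F :: "nat list \<Rightarrow> nat" where
  "val_F w = (\<Sum>i<length w. rev w ! i * F i)"

definition no_11 :: "nat list \<Rightarrow> bool" where
  "no_11 w \<longleftrightarrow> set w \<subseteq> {0, 1} \<and> successively (\<lambda>c d. \<not> (c = 1 \<and> d = 1)) w"

text \<open>For \<open>n = 0\<close> only the empty word qualifies, as \<open>val_F w > 0\<close> if \<open>w\<close> has a leading \<open>1\<close>.\<close>

definition is_rep_F :: "nat \<Rightarrow> nat list \<Rightarrow> bool" where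
  "is_rep_F n w \<longleftrightarrow> val_F w = n \<and> no_11 w \<and> (w \<noteq> [] \<longrightarrow> hd w \<noteq> 0)"

definition rep_F :: "nat \<Rightarrow> nat list" where
  "rep_F n = (THE w. is_rep_F n w)"

text \<open>Zeckendorf's theorem: the definite description is well defined.\<close>

lemma val_F_Nil [simp]: "val_F [] = 0"
  by (simp add: val_F_def)

lemma val_F_Cons [simp]: "val_F (d # w) = d * F (length w) + val_F w"
  by (simp add: val_F_def nth_append)

lemma no_11_Nil [simp]: "no_11 []"
  by (simp add: no_11_def)

lemma no_11_Cons:
  "no_11 (d # w) \<longleftrightarrow> no_11 w \<and> (d = 0 \<or> d = 1 \<and> (w = [] \<or> hd w = 0))"
  by (cases w) (auto simp: no_11_def)

lemma F_mono_Suc: "F n \<le> F (Suc n)"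
  by (cases n) (simp_all add: F_simps)

lemma F_mono: "m \<le> n \<Longrightarrow> F m \<le> F n"
  by (rule lift_Suc_mono_le[of F]) (rule F_mono_Suc)

lemma val_F_less: "no_11 w \<Longrightarrow> val_F w < F (length w)"
proof (induction w rule: length_induct)
  case (1 w)
  show ?case
  proof (cases w)
    case Nil
    then show ?thesis by (simp add: F_simps)
  next
    case w: (Cons d v)
    with 1 have v: "no_11 v" "val_F v < F (length v)"
      by (auto simp: no_11_Cons)
    show ?thesis
    proof (cases "d = 0")
      case True
      then show ?thesis using v w F_mono_Suc[of "length v"] by simp
    next
      case False
      then have d: "d = 1" "v = [] \<or> hd v = 0" using 1 w by (auto simp: no_11_Cons)
      show ?thesis
      proof (cases v)
        case Nil
        then show ?thesis using w d by (simp add: F_simps)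
      next
        case (Cons e u)
        with v d have "no_11 u" "e = 0" by (auto simp: no_11_Cons)
        moreover have "val_F u < F (length u)" using 1 w Cons \<open>no_11 u\<close> by auto
        ultimately show ?thesis using w d Cons by (simp add: F_simps)
      qed
    qed
  qed
qed

lemma val_F_inj:
  "length v = length w \<Longrightarrow> no_11 v \<Longrightarrow> no_11 w \<Longrightarrow> val_F v = val_F w \<Longrightarrow> v = w"
proof (induction v w rule: list_induct2)
  case Nil
  then show ?case by simp
next
  case (Cons c v d w)
  have "val_F v < F (length w)" "val_F w < F (length w)"
    using Cons val_F_less[of v] val_F_less[of w] by (auto simp: no_11_Cons)
  then have "c = d" using Cons by (auto simp: no_11_Cons)
  then show ?case using Cons by (auto simp: no_11_Cons)
qed

lemma ex_val_F: "n < F k \<Longrightarrow> \<exists>w. length w = k \<and> no_11 w \<and> val_F w = n"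
proof (induction k arbitrary: n rule: less_induct)
  case (less k)
  show ?case
  proof (cases k)
    case 0
    then show ?thesis using less by (simp add: F_simps)
  next
    case k: (Suc j)
    show ?thesis
    proof (cases "n < F j")
      case True
      then obtain w where "length w = j" "no_11 w" "val_F w = n" using less k by blast
      then show ?thesis using k by (intro exI[of _ "0 # w"]) (simp add: no_11_Cons)
    next
      case False
      show ?thesis
      proof (cases j)
        case 0
        then have "n = 1" using False less.prems k by (simp add: F_simps)
        then show ?thesis using k 0 by (intro exI[of _ "[1]"]) (simp add: no_11_Cons F_simps)
      next
        case j: (Suc i)
        then have "n - F j < F i" using False less.prems k by (simp add: F_simps)
        then obtain w where "length w = i" "no_11 w" "val_F w = n - F j"
          using less.IH[of i "n - F j"] k j by auto
        then show ?thesis using k j False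
          by (intro exI[of _ "1 # 0 # w"]) (simp add: no_11_Cons)
      qed
    qed
  qed
qed

lemma less_F: "n < F n"
  by (induction n rule: fib.induct) (simp_all add: F_simps)

lemma strip_zeros:
  "no_11 w \<Longrightarrow> \<exists>v. no_11 v \<and> val_F v = val_F w \<and> (v \<noteq> [] \<longrightarrow> hd v \<noteq> 0)"
proof (induction w)
  case Nil
  show ?case by (intro exI[of _ "[]"]) simp
next
  case (Cons d w)
  show ?case
  proof (cases "d = 0")
    case True
    then show ?thesis using Cons by (simp add: no_11_Cons)
  next
    case False
    then show ?thesis using Cons.prems by (intro exI[of _ "d # w"]) simp
  qed
qed

lemma is_rep_F_length_le:
  assumes "is_rep_F n v" "is_rep_F n w"
  shows "length v \<le> length w"
proof (cases v)
  case Nil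
  then show ?thesis by simp
next
  case (Cons d u)
  then have "d = 1" using assms by (auto simp: is_rep_F_def no_11_Cons)
  then have "F (length u) \<le> n" using Cons assms by (auto simp: is_rep_F_def)
  moreover have "n < F (length w)" using assms val_F_less[of w] by (auto simp: is_rep_F_def)
  ultimately have "\<not> length w \<le> length u" using F_mono[of "length w" "length u"] by linarith
  then show ?thesis using Cons by simp
qed

lemma ex1_is_rep_F: "\<exists>!w. is_rep_F n w"
proof (rule ex_ex1I)
  show "\<exists>w. is_rep_F n w"
    using ex_val_F[OF less_F[of n]] strip_zeros unfolding is_rep_F_def by metis
next
  fix v w
  assume vw: "is_rep_F n v" "is_rep_F n w"
  then have "length v = length w" using is_rep_F_length_le le_antisym by blast
  then show "v = w" using vw val_F_inj by (simp add: is_rep_F_def)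
qed

lemma is_rep_F_rep_F: "is_rep_F n (rep_F n)"
  unfolding rep_F_def using ex1_is_rep_F by (rule theI')

end

theory Submission
  imports Defs
begin

text \<open>
  The \<open>\<P>\<close>-positions are characterised as the kernel of the game graph. Besides the terminal
  positions, the kernel consists of the pairs with values \<open>(u0, u01)\<close>, where \<open>u\<close> is the
  representation of some \<open>n \<ge> 1\<close>, and of their mirror images. Their entries partition the
  integers \<open>\<ge> 2\<close> by the last digit, and since \<open>u00 - u0 = u\<close> by the Fibonacci recurrence, the
  two entries differ by exactly \<open>n + 1\<close>. So every row, column and diagonal that misses the
  terminal positions meets the kernel once, just as in Wythoff's original game.
\<close>

section \<open>Kernels and strategies\<close>

lemma K_move_less:
  assumes "K_move l p q"
  shows "fst q + snd q < fst p + snd p"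
  using assms by (cases p) (auto simp: K_move_def)

text \<open>Outside \<open>K\<close> the next player moves into \<open>K\<close>; by
  \<open>indep\<close> every reply leaves \<open>K\<close> again, so the situation recurs with a
  smaller coordinate sum. Play can therefore stop only after a move of the next player.\<close>

lemma ex_losing_play:
  assumes s: "strategy l s"
    and indep: "\<And>p q. K p \<Longrightarrow> K_move l p q \<Longrightarrow> \<not> K q"
    and absorb: "\<And>p. \<not> K p \<Longrightarrow> \<exists>q. K_move l p q \<and> K q"
  shows "\<lbrakk>play_from l p h; prev_follows s h; odd (length h); \<not> K (last h)\<rbrakk> \<Longrightarrow>
    \<exists>h'. play_from l p h' \<and> prev_follows s h' \<and> finished l h' \<and> even (length h')"
proof (induction "fst (last h) + snd (last h)" arbitrary: h rule: less_induct)
  case less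
  obtain q where q: "K_move l (last h) q" "K q"
    using absorb less.prems by blast
  let ?h = "h @ [q]"
  have play: "play_from l p ?h"
    using less.prems q by (auto simp: play_from_def successively_append_iff)
  \<comment> \<open>The new index \<open>length h\<close> is odd, so \<open>prev_follows\<close>
    puts no condition on \<open>q\<close>.\<close>
  have follow: "prev_follows s ?h"
    using less.prems by (auto simp: prev_follows_def nth_append less_Suc_eq)
  show ?case
  proof (cases "finished l ?h")
    case True
    then show ?thesis using play follow less.prems by (intro exI[of _ ?h]) simp
  next
    case False
    define r where "r = s ?h"
    have r: "K_move l q r"
      using s False by (auto simp: strategy_def r_def)
    let ?h' = "?h @ [r]"
    have "play_from l p ?h'"
      using play r unfolding play_from_def by (subst successively_append_iff) (auto simp: hd_append)
    moreover have "prev_follows s ?h'"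
      unfolding prev_follows_def
    proof (intro allI impI)
      fix n assume n: "0 < n \<and> n < length ?h' \<and> even n"
      show "?h' ! n = s (take n ?h')"
      proof (cases "n = length ?h")
        case True
        then show ?thesis by (simp add: r_def nth_append)
      next
        case False
        then have "n < length ?h" using n by simp
        then have "?h' ! n = ?h ! n" "take n ?h' = take n ?h"
          by (simp_all add: nth_append)
        moreover have "?h ! n = s (take n ?h)"
          using follow n \<open>n < length ?h\<close> unfolding prev_follows_def by blast
        ultimately show ?thesis by simp
      qed
    qed
    moreover have "fst r + snd r < fst (last h) + snd (last h)"
      using K_move_less[OF q(1)] K_move_less[OF r] by simp
    ultimately show ?thesis
      using less.hyps[of ?h'] less.prems indep[OF q(2) r] by simp
  qed
qed

text \<open>If \<open>p\<close> is outside \<open>K\<close>, \<open>ex_losing_play\<close> defeats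
  every strategy of the previous player. If \<open>p\<close> is in \<open>K\<close>, moving back
  into \<open>K\<close> at each turn wins.\<close>

lemma P_position_iff_kernel:
  assumes indep: "\<And>p q. K p \<Longrightarrow> K_move l p q \<Longrightarrow> \<not> K q"
    and absorb: "\<And>p. \<not> K p \<Longrightarrow> \<exists>q. K_move l p q \<and> K q"
  shows "P_position l p \<longleftrightarrow> K p"
proof
  assume P: "P_position l p"
  then obtain s where s: "strategy l s"
    and win: "\<And>h. play_from l p h \<Longrightarrow> prev_follows s h \<Longrightarrow> finished l h \<Longrightarrow> odd (length h)"
    unfolding P_position_def by blast
  show "K p"
  proof (rule ccontr)
    assume "\<not> K p"
    then have "\<exists>h'. play_from l p h' \<and> prev_follows s h' \<and> finished l h' \<and> even (length h')"
      using indep absorb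
      by (intro ex_losing_play[where h = "[p]" and K = K, OF s])
        (auto simp: play_from_def prev_follows_def)
    then show False using win by blast
  qed
next
  assume Kp: "K p"
  \<comment> \<open>At positions in \<open>K\<close> any legal move will do: \<open>strategy\<close>
    demands one at every unfinished history.\<close>
  define s where "s h =
    (if K (last h) then SOME q. K_move l (last h) q else SOME q. K_move l (last h) q \<and> K q)" for h
  have s_K: "K_move l (last h) (s h) \<and> K (s h)" if "\<not> K (last h)" for h
    using someI_ex[OF absorb[OF that]] that by (simp add: s_def)
  have "strategy l s"
    unfolding strategy_def
  proof (intro allI impI)
    fix h assume h: "h \<noteq> [] \<and> \<not> finished l h"
    show "K_move l (last h) (s h)"
    proof (cases "K (last h)")
      case True
      then show ?thesis using h by (auto simp: s_def finished_def intro: someI)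
    qed (use s_K in blast)
  qed
  moreover have "odd (length h)"
    if h: "play_from l p h" "prev_follows s h" "finished l h" for h
  proof -
    have move: "K_move l (h ! n) (h ! Suc n)" if "Suc n < length h" for n
      using h that by (auto simp: play_from_def successively_conv_nth)
    have inv: "n < length h \<Longrightarrow> K (h ! n) \<longleftrightarrow> even n" for n
    proof (induction n)
      case 0
      then show ?case using h Kp by (auto simp: play_from_def hd_conv_nth)
    next
      case (Suc n)
      show ?case
      proof (cases "even n")
        case True
        then show ?thesis using Suc indep[OF _ move[OF Suc.prems]] by simp
      next
        case False
        have "last (take (Suc n) h) = h ! n"
          using Suc.prems by (simp add: take_Suc_conv_app_nth)
        then have "K (s (take (Suc n) h))"
          using s_K[of "take (Suc n) h"] Suc False by simp
        moreover have "h ! Suc n = s (take (Suc n) h)"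
          using h(2) Suc.prems False by (simp add: prev_follows_def)
        ultimately show ?thesis using False by simp
      qed
    qed
    have "h \<noteq> []" using h by (simp add: play_from_def)
    \<comment> \<open>Outside \<open>K\<close> there is always a move, so a finished play ends in
      \<open>K\<close>, at an even index.\<close>
    have "K (last h)"
      using h(3) absorb unfolding finished_def by blast
    then have "even (length h - 1)"
      using inv[of "length h - 1"] \<open>h \<noteq> []\<close> by (simp add: last_conv_nth)
    then show ?thesis using \<open>h \<noteq> []\<close> by (cases h) auto
  qed
  ultimately show "P_position l p" unfolding P_position_def by blast
qed

section \<open>Shifting Fibonacci representations\<close>

lemma rep_F_eqI: "is_rep_F n w \<Longrightarrow> rep_F n = w"
  unfolding rep_F_def by (rule the1_equality[OF ex1_is_rep_F])

lemma val_F_rep_F [simp]: "val_F (rep_F n) = n"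
  using is_rep_F_rep_F[of n] by (simp add: is_rep_F_def)

lemma rep_F_Nil_iff: "rep_F n = [] \<longleftrightarrow> n = 0"
proof
  assume "rep_F n = []"
  then show "n = 0" using val_F_rep_F[of n] val_F_Nil by metis
next
  assume "n = 0"
  then show "rep_F n = []" using rep_F_eqI[of 0 "[]"] by (simp add: is_rep_F_def)
qed

lemma val_F_snoc: "val_F (w @ [d]) = val_F (w @ [0]) + d"
  by (induction w) (simp_all add: F_simps)

lemma val_F_shift_twice: "val_F (w @ [0, 0]) = val_F (w @ [0]) + val_F w"
  by (induction w) (simp_all add: F_simps algebra_simps)

lemma no_11_snoc:
  "no_11 (w @ [d]) \<longleftrightarrow> no_11 w \<and> (d = 0 \<or> d = 1 \<and> (w = [] \<or> last w = 0))"
proof (cases "w = []")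
  case False
  have "last w = 0 \<or> last w = 1" if "set w \<subseteq> {0, 1}"
    using that last_in_set[OF False] by auto
  then show ?thesis using False unfolding no_11_def successively_append_iff by auto
qed (auto simp: no_11_def)

lemma val_F_pad [simp]: "val_F (replicate k 0 @ w) = val_F w"
  by (induction k) simp_all

lemma no_11_pad: "no_11 w \<Longrightarrow> no_11 (replicate k 0 @ w)"
  by (induction k) (simp_all add: no_11_Cons)

text \<open>The order of the values is lexicographic: by \<open>val_F_less\<close>, the weight of
  the first differing digit exceeds all that can follow, before and after the shift.\<close>

lemma val_F_shift_mono_aux:
  "\<lbrakk>length v = length w; no_11 v; no_11 w; val_F v < val_F w\<rbrakk> \<Longrightarrow>
    val_F (v @ [0]) < val_F (w @ [0])"
proof (induction v w rule: list_induct2)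
  case Nil
  then show ?case by simp
next
  case (Cons c v d w)
  have no: "no_11 v" "no_11 w" and dig: "c \<in> {0, 1}" "d \<in> {0, 1}"
    using Cons.prems by (auto simp: no_11_Cons)
  have "no_11 (v @ [0])" using no by (simp add: no_11_snoc)
  then have "val_F (v @ [0]) < F (Suc (length w))"
    using val_F_less[of "v @ [0]"] Cons.hyps by simp
  moreover have "val_F w < F (length w)" using no val_F_less by blast
  ultimately show ?case using Cons no dig by auto
qed

lemma val_F_shift_mono:
  assumes "no_11 v" "no_11 w" "val_F v < val_F w"
  shows "val_F (v @ [0]) < val_F (w @ [0])"
  \<comment> \<open>Leading zeros bring both words to the same length without changing their
    values.\<close>
  using val_F_shift_mono_aux[of "replicate (length w) 0 @ v" "replicate (length v) 0 @ w"] assms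
  by (simp add: no_11_pad)

text \<open>For \<open>n\<close> = 1, ..., 5 the values are 2, 3, 5, 7, 8; on positive
  \<open>n\<close> it enumerates the numbers whose representation ends in 0.\<close>

definition shift_F :: "nat \<Rightarrow> nat" where
  "shift_F n = val_F (rep_F n @ [0])"

lemma shift_F_mono: "m < n \<Longrightarrow> shift_F m < shift_F n"
  unfolding shift_F_def using is_rep_F_rep_F
  by (intro val_F_shift_mono) (auto simp: is_rep_F_def)

lemma shift_F_inj: "shift_F m = shift_F n \<longleftrightarrow> m = n"
  using shift_F_mono[of m n] shift_F_mono[of n m] by (cases m n rule: linorder_cases) auto

lemma is_rep_F_snoc:
  assumes "is_rep_F n u" "0 < n" "d = 0 \<or> d = 1 \<and> last u = 0"
  shows "is_rep_F (val_F (u @ [d])) (u @ [d])"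
proof -
  have "u \<noteq> []" using assms by (auto simp: is_rep_F_def)
  then show ?thesis using assms by (auto simp: is_rep_F_def no_11_snoc hd_append)
qed

lemma rep_F_shift:
  assumes "0 < n"
  shows "rep_F (shift_F n) = rep_F n @ [0]"
  unfolding shift_F_def using is_rep_F_snoc[OF is_rep_F_rep_F assms, of 0]
  by (intro rep_F_eqI) simp

lemma shift_F_ge_2:
  assumes "0 < n"
  shows "2 \<le> shift_F n"
proof -
  obtain d u where u: "rep_F n = d # u"
    using assms rep_F_Nil_iff by (cases "rep_F n") auto
  then have "d \<noteq> 0" using is_rep_F_rep_F[of n] by (simp add: is_rep_F_def)
  moreover have "2 \<le> F (Suc (length u))"
    using F_mono[of 1 "Suc (length u)"] by (simp add: F_simps)
  ultimately show ?thesis using u by (cases d) (auto simp: shift_F_def)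
qed

text \<open>With \<open>u = rep_F n\<close>, the value of u01 is that of u00 plus 1, and the
  recurrence splits u00 into u0 and u.\<close>

lemma rep_F_shift_partner:
  assumes "0 < n"
  shows "rep_F (shift_F n + n + 1) = rep_F n @ [0, 1]"
proof -
  have "is_rep_F (shift_F n) (rep_F n @ [0])"
    using rep_F_shift[OF assms] is_rep_F_rep_F by metis
  from is_rep_F_snoc[OF this, of 1] have "is_rep_F (val_F (rep_F n @ [0, 1])) (rep_F n @ [0, 1])"
    using shift_F_ge_2[OF assms] by simp
  moreover have "val_F (rep_F n @ [0, 1]) = shift_F n + n + 1"
    using val_F_snoc[of "rep_F n @ [0]" 1] val_F_shift_twice[of "rep_F n"]
    by (simp add: shift_F_def)
  ultimately show ?thesis by (intro rep_F_eqI) simp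
qed

lemma eq_shift_F:
  assumes "0 < a" "last (rep_F a) = 0"
  shows "\<exists>n>0. a = shift_F n \<and> rep_F a = rep_F n @ [0]"
proof -
  obtain u where u: "rep_F a = u @ [0]"
    using assms rep_F_Nil_iff[of a] by (cases "rep_F a" rule: rev_cases) auto
  have rep: "is_rep_F a (u @ [0])" using is_rep_F_rep_F[of a] u by simp
  then have "u \<noteq> []" by (auto simp: is_rep_F_def)
  then have "is_rep_F (val_F u) u" using rep by (auto simp: is_rep_F_def no_11_snoc)
  then have *: "rep_F (val_F u) = u" by (rule rep_F_eqI)
  then have "0 < val_F u" using \<open>u \<noteq> []\<close> rep_F_Nil_iff[of "val_F u"] by auto
  then show ?thesis using * u val_F_rep_F[of a]
    by (intro exI[of _ "val_F u"]) (simp add: shift_F_def)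
qed

text \<open>Turns the condition on words into arithmetic: the common prefix u of u0 and u01 yields
  \<open>n\<close> as its value.\<close>

lemma rep_pair_iff:
  "a \<ge> 1 \<and> last (rep_F a) = 0 \<and> rep_F b = rep_F a @ [1] \<longleftrightarrow>
    (\<exists>n>0. a = shift_F n \<and> b = shift_F n + n + 1)" (is "?L \<longleftrightarrow> ?R")
proof
  assume ?L
  then obtain n where n: "0 < n" "a = shift_F n" "rep_F a = rep_F n @ [0]"
    using eq_shift_F[of a] by auto
  then have "rep_F b = rep_F (shift_F n + n + 1)"
    using \<open>?L\<close> rep_F_shift_partner by simp
  then have "val_F (rep_F b) = val_F (rep_F (shift_F n + n + 1))" by (rule arg_cong)
  then have "b = shift_F n + n + 1" by (simp only: val_F_rep_F)
  then show ?R using n by blast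
next
  assume ?R
  then obtain n where n: "0 < n" "a = shift_F n" "b = shift_F n + n + 1" by blast
  have "rep_F a = rep_F n @ [0]" "rep_F b = rep_F n @ [0, 1]"
    unfolding n using n(1) by (rule rep_F_shift, rule rep_F_shift_partner)
  then show ?L using shift_F_ge_2[OF n(1)] n(2) by simp
qed

lemma shift_F_neq_partner:
  assumes "0 < m" "0 < n"
  shows "shift_F m \<noteq> shift_F n + n + 1"
proof
  assume "shift_F m = shift_F n + n + 1"
  then have "rep_F (shift_F m) = rep_F (shift_F n + n + 1)" by (rule arg_cong)
  then have "last (rep_F m @ [0]) = last (rep_F n @ [0, 1])"
    unfolding rep_F_shift[OF assms(1)] rep_F_shift_partner[OF assms(2)] by (rule arg_cong)
  then show False by simp
qed

text \<open>The last digit decides the case. A final 1 is preceded by 0, so removing it leaves a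
  word to which \<open>rep_pair_iff\<close> applies.\<close>

lemma shift_F_cases:
  assumes "2 \<le> x"
  obtains n where "0 < n" "x = shift_F n" | n where "0 < n" "x = shift_F n + n + 1"
proof (cases "last (rep_F x) = 0")
  case True
  then show thesis using eq_shift_F[of x] assms that by auto
next
  case False
  obtain u d where u: "rep_F x = u @ [d]"
    using assms rep_F_Nil_iff[of x] by (cases "rep_F x" rule: rev_cases) auto
  have rep: "is_rep_F x (u @ [d])" using is_rep_F_rep_F[of x] u by simp
  have d: "d = 1" using False u rep by (auto simp: is_rep_F_def no_11_snoc)
  \<comment> \<open>The one-letter word 1 has value 1, below the bound on \<open>x\<close>.\<close>
  have "u \<noteq> []" using rep assms d by (auto simp: is_rep_F_def F_simps)
  have "is_rep_F (val_F u) u" "last u = 0"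
    using rep \<open>u \<noteq> []\<close> d by (auto simp: is_rep_F_def no_11_snoc)
  moreover from this have "rep_F (val_F u) = u" by (intro rep_F_eqI)
  ultimately have "val_F u \<ge> 1 \<and> last (rep_F (val_F u)) = 0 \<and> rep_F x = rep_F (val_F u) @ [1]"
    using u d \<open>u \<noteq> []\<close> rep_F_Nil_iff[of "val_F u"] by auto
  then show thesis using that unfolding rep_pair_iff by blast
qed

section \<open>The kernel of the game with three terminal positions\<close>

text \<open>The coordinate differences of the pairs start at 2, since 0 and 1 belong to the terminal
  positions.\<close>

definition kernel_le :: "nat \<Rightarrow> nat \<Rightarrow> bool" where
  "kernel_le x y \<longleftrightarrow> x = 0 \<and> y \<le> 1 \<or> (\<exists>n>0. x = shift_F n \<and> y = shift_F n + n + 1)"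

definition kernel :: "position \<Rightarrow> bool" where
  "kernel p \<longleftrightarrow> kernel_le (fst p) (snd p) \<or> kernel_le (snd p) (fst p)"

lemma kernel_swap: "kernel (y, x) = kernel (x, y)"
  by (auto simp: kernel_def)

text \<open>By its last digit \<open>x\<close> is a smaller or a larger entry, never both, and
  either kind determines \<open>n\<close> by strict monotonicity. Row 0 contains both (0,0) and
  (0,1), whence the bound on \<open>x\<close>.\<close>

lemma kernel_row_unique:
  assumes "kernel (x, y)" "kernel (x, y')" "2 \<le> x"
  shows "y = y'"
proof -
  have partner_inj: "m = n" if "shift_F m + m + 1 = shift_F n + n + 1" for m n
    using that shift_F_mono[of m n] shift_F_mono[of n m] by linarith
  have row: "(\<exists>n>0. x = shift_F n \<and> z = shift_F n + n + 1) \<or>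
      (\<exists>n>0. z = shift_F n \<and> x = shift_F n + n + 1)" if "kernel (x, z)" for z
    using that \<open>2 \<le> x\<close> by (auto simp: kernel_def kernel_le_def)
  from \<open>2 \<le> x\<close> show ?thesis
  proof (cases rule: shift_F_cases)
    case (1 n)
    have "z = shift_F n + n + 1" if z: "kernel (x, z)" for z
      using row[OF z]
    proof (elim disjE exE conjE)
      fix m assume "x = shift_F m" "z = shift_F m + m + 1"
      then show ?thesis using 1 shift_F_inj by simp
    next
      fix m assume "0 < m" "x = shift_F m + m + 1"
      then show ?thesis using 1 shift_F_neq_partner[of n m] by simp
    qed
    then show ?thesis using assms by blast
  next
    case (2 n)
    have "z = shift_F n" if z: "kernel (x, z)" for z
      using row[OF z]
    proof (elim disjE exE conjE)
      fix m assume "0 < m" "x = shift_F m"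
      then show ?thesis using 2 shift_F_neq_partner[of m n] by simp
    next
      fix m assume "z = shift_F m" "x = shift_F m + m + 1"
      then show ?thesis using 2 partner_inj[of m n] by simp
    qed
    then show ?thesis using assms by blast
  qed
qed

lemma kernel_independent:
  assumes "kernel p" "K_move 1 p q"
  shows "\<not> kernel q"
proof
  assume q: "kernel q"
  obtain x y where p: "p = (x, y)" by (cases p)
  have nonterm: "x + y > 1" using assms p by (simp add: K_move_def terminal_def)
  then obtain n where n: "0 < n" and xy:
    "x = shift_F n \<and> y = shift_F n + n + 1 \<or> y = shift_F n \<and> x = shift_F n + n + 1"
    using assms(1) p by (auto simp: kernel_def kernel_le_def)
  then have ge: "2 \<le> x" "2 \<le> y" using shift_F_ge_2[OF n] by auto
  consider i where "1 \<le> i" "i \<le> x" "q = (x - i, y)" | i where "1 \<le> i" "i \<le> y" "q = (x, y - i)"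
    | i where "1 \<le> i" "i \<le> min x y" "q = (x - i, y - i)"
    using assms(2) p by (auto simp: K_move_def)
  then show False
  proof cases
    case 1
    then show ?thesis
      using kernel_row_unique[of y x "x - i"] assms(1) q p ge kernel_swap by auto
  next
    case 2
    then show ?thesis
      using kernel_row_unique[of x y "y - i"] assms(1) q p ge by auto
  next
    case 3
    \<comment> \<open>Diagonal moves keep the difference. Being at least 2, it rules out terminal
      positions, and it determines the pair, so \<open>i\<close> would be 0.\<close>
    have "\<bar>int (x - i) - int (y - i)\<bar> = int n + 1"
      using 3 xy by (auto simp: of_nat_diff)
    moreover from this q 3 n obtain m where m: "0 < m"
      "x - i = shift_F m \<and> y - i = shift_F m + m + 1 \<or>
       y - i = shift_F m \<and> x - i = shift_F m + m + 1"
      by (auto simp: kernel_def kernel_le_def)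
    ultimately have "m = n" by auto
    then show ?thesis using m xy 3 by auto
  qed
qed

text \<open>If \<open>x\<close> is a larger entry, lower \<open>y\<close> to its smaller partner. If
  \<open>x\<close> is a smaller entry, lower \<open>y\<close> to the partner when \<open>y\<close>
  is above it; otherwise descend the diagonal.\<close>

lemma kernel_absorbing_le:
  assumes "\<not> kernel (x, y)" "x \<le> y"
  shows "\<exists>q. K_move 1 (x, y) q \<and> kernel q"
proof -
  have nonterm: "\<not> terminal 1 (x, y)"
  proof
    assume "terminal 1 (x, y)"
    then have "x = 0 \<and> y \<le> 1" using \<open>x \<le> y\<close> by (auto simp: terminal_def)
    then show False using assms by (simp add: kernel_def kernel_le_def)
  qed
  have down: ?thesis if "z < y" "kernel (x, z)" for z
    using that nonterm
    by (intro exI[of _ "(x, z)"]) (auto simp: K_move_def intro!: exI[of _ "y - z"])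
  have diag: ?thesis if "z < x" "kernel (z, z + (y - x))" for z
    using that nonterm \<open>x \<le> y\<close>
    by (intro exI[of _ "(z, z + (y - x))"]) (auto simp: K_move_def intro!: exI[of _ "x - z"])
  show ?thesis
  proof (cases "2 \<le> x")
    case False
    then have "x \<le> 1" by simp
    then have "kernel (x, 0)" by (auto simp: kernel_def kernel_le_def)
    moreover from this have "0 < y" using assms by (cases y) auto
    ultimately show ?thesis using down by blast
  next
    case True
    then show ?thesis
    proof (cases rule: shift_F_cases)
      case (2 n)
      then have "kernel (x, shift_F n)" by (auto simp: kernel_def kernel_le_def)
      then show ?thesis using down[of "shift_F n"] 2 \<open>x \<le> y\<close> by simp
    next
      case (1 n)
      then have ker: "kernel (x, x + n + 1)" by (auto simp: kernel_def kernel_le_def)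
      then have "y \<noteq> x + n + 1" using assms by blast
      then consider "x + n + 1 < y" | "y < x + n + 1" by linarith
      then show ?thesis
      proof cases
        case 1
        then show ?thesis using down ker by blast
      next
        case less: 2
        show ?thesis
        proof (cases "y - x \<le> 1")
          case True
          then have "kernel (0, 0 + (y - x))" by (simp add: kernel_def kernel_le_def)
          then show ?thesis using diag[of 0] \<open>2 \<le> x\<close> by simp
        next
          case False
          \<comment> \<open>The pair of index \<open>m\<close> has difference \<open>m + 1\<close>,
            so it lies on the diagonal of \<open>(x, y)\<close>; \<open>m < n\<close> puts it below
            \<open>x\<close>.\<close>
          define m where "m = y - x - 1"
          have m: "0 < m" "m < n" "y - x = m + 1" using False less by (auto simp: m_def)
          then have "kernel (shift_F m, shift_F m + (y - x))"
            by (auto simp: kernel_def kernel_le_def)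
          then show ?thesis using diag shift_F_mono m 1 by blast
        qed
      qed
    qed
  qed
qed

lemma K_move_swap: "K_move l (x, y) (u, v) \<Longrightarrow> K_move l (y, x) (v, u)"
  by (auto simp: K_move_def terminal_def)

lemma kernel_absorbing:
  assumes "\<not> kernel p"
  shows "\<exists>q. K_move 1 p q \<and> kernel q"
proof -
  obtain x y where p: "p = (x, y)" by (cases p)
  show ?thesis
  proof (cases "x \<le> y")
    case True
    then show ?thesis using assms p kernel_absorbing_le by blast
  next
    case False
    then obtain u v where "K_move 1 (y, x) (u, v)" "kernel (u, v)"
      using kernel_absorbing_le[of y x] assms p kernel_swap by auto
    then show ?thesis using K_move_swap kernel_swap p by blast
  qed
qed

theorem theorem12:
  fixes a b :: nat
  assumes "a \<le> b"
  shows "P_position 1 (a, b) \<longleftrightarrow>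
    (a, b) \<in> {(0, 0), (0, 1)} \<or>
    (a \<ge> 1 \<and> last (rep_F a) = 0 \<and> rep_F b = rep_F a @ [1])"
proof -
  have "P_position 1 (a, b) \<longleftrightarrow> kernel (a, b)"
    by (rule P_position_iff_kernel[OF kernel_independent kernel_absorbing])
  \<comment> \<open>For \<open>a \<le> b\<close> the mirrored disjunct can only hold at (0,0), which
    \<open>kernel_le a b\<close> already covers.\<close>
  also have "\<dots> \<longleftrightarrow> kernel_le a b"
    using assms by (auto simp: kernel_def kernel_le_def)
  finally show ?thesis
    unfolding rep_pair_iff by (auto simp: kernel_le_def le_Suc_eq)
qed

end
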